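(* Let $G$ be a chordal graph. Then $\mathcal{S}^*(G)$ is realizable as a rank-one generated (ROG) hyperbolicity cone if and only if $G$ is a disjoint union of cliques.
   Context: Graphs are finite, simple and undirected. $\mathcal{S}^n$ is the space of real symmetric $n\times n$ matrices. For a graph $G$ with vertices $\{1,\dots,n\}$ and edge set $E$, put $\mathcal{S}(G)=\{X\in\mathcal{S}^n \mid X_{ij}=0 \text{ for all } i\neq j \text{ with } \{i,j\}\notin E\}$ and $\mathcal{S}^*(G)=\{A\in\mathcal{S}(G)\mid A_C\succeq 0 \text{ for all cliques } C \text{ of } G\}$, where $A_C$ is the principal submatrix indexed by the vertices of $C$. A graph is chordal if every cycle of length at least 4 has a chord. "Disjoint union of cliques" means that every connected component of $G$ is a complete graph. A homogeneous polynomial $p$ on a finite-dimensional real Euclidean space $\mathcal{V}$ is hyperbolic along $e\in\mathcal{V}$ if $p(e)>0$ and for every $x\in\mathcal{V}$ the univariate polynomial $t\mapsto p(x-te)$ has only real roots; its hyperbolicity cone is $\Lambda_+(p,e)=\{x\in\mathcal{V}\mid \text{all roots of } t\mapsto p(te-x) \text{ are nonnegative}\}$. The rank of $x\in\mathcal{V}$ (with respect to $p$ and $e$) is the number of nonzero roots, counted with multiplicity, of $t\mapsto p(te-x)$. $\Lambda_+(p,e)$ is rank-one generated (ROG) with respect to $p$ if all its extreme rays are generated by elements of rank $1$. A closed convex cone $K\subseteq \mathcal{V}$ is realizable as a ROG hyperbolicity cone if there exist $p$ and $e$, with $p$ hyperbolic along $e$, such that $K=\Lambda_+(p,e)$ and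 $\Lambda_+(p,e)$ is ROG with respect to $p$. For $\mathcal{S}^*(G)$ the ambient space is $\mathcal{V}=\mathcal{S}(G)$. *)

theory Defs
  imports
    "HOL-Analysis.Analysis"
    "HOL-Library.Ramsey"
    "HOL-Computational_Algebra.Polynomial"
begin

section \<open>Graphs\<close>

text \<open>
  A graph is given by its edge set; its vertices are all elements of the finite type
  \<^typ>\<open>'n\<close>, which plays the role of $\{1,\dots,n\}$. Cliques are those of
  \<^theory>\<open>HOL-Library.Ramsey\<close>.
\<close>

definition simple_graph :: "'n set set \<Rightarrow> bool" where
  "simple_graph E \<longleftrightarrow> (\<forall>e\<in>E. card e = 2)"

definition cycle_edges :: "'n list \<Rightarrow> 'n set set" where
  "cycle_edges vs = {{vs ! i, vs ! (Suc i mod length vs)} | i. i < length vs}"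

definition is_cycle :: "'n set set \<Rightarrow> 'n list \<Rightarrow> bool" where
  "is_cycle E vs \<longleftrightarrow> 3 \<le> length vs \<and> distinct vs \<and> cycle_edges vs \<subseteq> E"

definition has_chord :: "'n set set \<Rightarrow> 'n list \<Rightarrow> bool" where
  "has_chord E vs \<longleftrightarrow> (\<exists>e\<in>E. e \<subseteq> set vs \<and> e \<notin> cycle_edges vs)"

definition chordal :: "'n set set \<Rightarrow> bool" where
  "chordal E \<longleftrightarrow> (\<forall>vs. is_cycle E vs \<and> 4 \<le> length vs \<longrightarrow> has_chord E vs)"

definition component_of_vertex :: "'n set set \<Rightarrow> 'n \<Rightarrow> 'n set" where
  "component_of_vertex E v = {(u, w). {u, w} \<in> E}\<^sup>* `` {v}"

definition disjoint_union_of_cliques :: "'n set set \<Rightarrow> bool" where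
  "disjoint_union_of_cliques E \<longleftrightarrow> (\<forall>v. clique (component_of_vertex E v) E)"

section \<open>The cones of a graph\<close>

definition graph_matrices :: "'n::finite set set \<Rightarrow> (real^'n^'n) set" where
  "graph_matrices E =
     {X. transpose X = X \<and> (\<forall>i j. i \<noteq> j \<and> {i, j} \<notin> E \<longrightarrow> X $ i $ j = 0)}"

text \<open>
  Positive semidefiniteness of the principal submatrix of a symmetric matrix \<open>A\<close> with
  rows and columns in \<open>C\<close>; only the coordinates \<open>x i\<close> with \<open>i \<in> C\<close> matter.
\<close>

definition psd_submatrix :: "'n::finite set \<Rightarrow> real^'n^'n \<Rightarrow> bool" where
  "psd_submatrix C A \<longleftrightarrow> (\<forall>x :: 'n \<Rightarrow> real. 0 \<le> (\<Sum>i\<in>C. \<Sum>j\<in>C. x i * A $ i $ j * x j))"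

definition graph_cone :: "'n::finite set set \<Rightarrow> (real^'n^'n) set" where
  "graph_cone E = {A \<in> graph_matrices E. \<forall>C. clique C E \<longrightarrow> psd_submatrix C A}"

section \<open>Hyperbolic polynomials on a subspace\<close>

text \<open>
  A polynomial on a linear subspace \<open>V\<close> is represented by a polynomial function on the whole
  space, of which only the values on \<open>V\<close> are used. Every polynomial on \<open>V\<close> arises in
  this way, by composing it with a linear projection onto \<open>V\<close>.
\<close>

definition homogeneous_on :: "'a::real_normed_vector set \<Rightarrow> ('a \<Rightarrow> real) \<Rightarrow> bool" where
  "homogeneous_on V p \<longleftrightarrow> (\<exists>d::nat. \<forall>x\<in>V. \<forall>c. p (c *\<^sub>R x) = c ^ d * p x)"

text \<open>The univariate polynomial $t \mapsto p(a + t v)$.\<close>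

definition line_poly :: "('a::real_normed_vector \<Rightarrow> real) \<Rightarrow> 'a \<Rightarrow> 'a \<Rightarrow> real poly" where
  "line_poly p a v = (THE q. \<forall>t. poly q t = p (a + t *\<^sub>R v))"

lemma poly_line_poly:
  assumes "real_polynomial_function p"
  shows "poly (line_poly p a v) t = p (a + t *\<^sub>R v)"
proof -
  have "\<exists>q. \<forall>t. poly q t = p (a + t *\<^sub>R v)"
    using assms
  proof induction
    case (linear f)
    then have "\<forall>t. poly [:f a, f v:] t = f (a + t *\<^sub>R v)"
      by (simp add: linear_simps bounded_linear.linear)
    then show ?case by blast
  next
    case (const c)
    have "\<forall>t. poly [:c:] t = c" by simp
    then show ?case by blast
  next
    case (add f g)
    then show ?case by (metis poly_add)
  next
    case (mult f g)
    then show ?case by (metis poly_mult)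
  qed
  then obtain q where q: "\<forall>t. poly q t = p (a + t *\<^sub>R v)" by blast
  have "line_poly p a v = q"
    unfolding line_poly_def
    by (rule the_equality) (use q in \<open>auto simp flip: poly_eq_poly_eq_iff\<close>)
  with q show ?thesis by simp
qed

definition real_rooted :: "real poly \<Rightarrow> bool" where
  "real_rooted q \<longleftrightarrow> (\<forall>z::complex. poly (map_poly of_real q) z = 0 \<longrightarrow> z \<in> \<real>)"

definition hyperbolic_on :: "'a::euclidean_space set \<Rightarrow> ('a \<Rightarrow> real) \<Rightarrow> 'a \<Rightarrow> bool" where
  "hyperbolic_on V p e \<longleftrightarrow>
     real_polynomial_function p \<and> homogeneous_on V p \<and> e \<in> V \<and> 0 < p e \<and>
     (\<forall>x\<in>V. real_rooted (line_poly p x (- e)))"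

text \<open>
  The next two notions are used for hyperbolic \<open>p\<close> only; then all complex roots of
  $t \mapsto p(te - x)$ are real, so that it suffices to consider the real ones.
\<close>

definition hyperbolicity_cone :: "'a::euclidean_space set \<Rightarrow> ('a \<Rightarrow> real) \<Rightarrow> 'a \<Rightarrow> 'a set" where
  "hyperbolicity_cone V p e =
     {x \<in> V. \<forall>t. poly (line_poly p (- x) e) t = 0 \<longrightarrow> 0 \<le> t}"

definition hyperbolic_rank :: "('a::euclidean_space \<Rightarrow> real) \<Rightarrow> 'a \<Rightarrow> 'a \<Rightarrow> nat" where
  "hyperbolic_rank p e x =
     (\<Sum>t | t \<noteq> 0 \<and> poly (line_poly p (- x) e) t = 0. order t (line_poly p (- x) e))"

definition extreme_ray :: "'a::euclidean_space set \<Rightarrow> 'a set \<Rightarrow> bool" where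
  "extreme_ray R K \<longleftrightarrow> R face_of K \<and> (\<exists>x. x \<noteq> 0 \<and> R = cone hull {x})"

definition rank_one_generated ::
  "'a::euclidean_space set \<Rightarrow> ('a \<Rightarrow> real) \<Rightarrow> 'a \<Rightarrow> bool" where
  "rank_one_generated V p e \<longleftrightarrow>
     (\<forall>R. extreme_ray R (hyperbolicity_cone V p e) \<longrightarrow>
        (\<exists>x. hyperbolic_rank p e x = 1 \<and> R = cone hull {x}))"

definition ROG_realizable :: "'a::euclidean_space set \<Rightarrow> 'a set \<Rightarrow> bool" where
  "ROG_realizable V K \<longleftrightarrow>
     (\<exists>p e. hyperbolic_on V p e \<and> K = hyperbolicity_cone V p e \<and> rank_one_generated V p e)"

end

(*
  If G is not a disjoint union of cliques, it has an induced path a - b - c. For v supported on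
  {a, b, c}, the matrix v v^T with its (a, c) entries set to zero spans an extreme ray of S*(G)
  when v_b \<noteq> 0, so in a ROG realization it has rank one, which makes p affine along it from e.
  Letting v_b tend to 0, p is affine from e along x E_aa + y E_cc for all x, y \<ge> 0. But membership
  of e - (x E_aa + y E_cc) in S*(G) separates into a condition on x and one on y, whence the slope
  of p is the maximum of two linear forms, which is not a polynomial.

  Conversely, for a disjoint union of cliques, S*(G) consists of the positive semidefinite matrices
  in S(G), p = det and e = I realize it, and extreme rays are spanned by matrices y y^T.
*)

theory Submission
  imports Defs "HOL-Computational_Algebra.Fundamental_Theorem_Algebra"
begin

text \<open>For positive x and y the matrix x E_aa + y E_cc is not extreme, so rank-one generation
  says nothing about it directly. It is still a limit of extreme rays, because zeroing the entries
  at (a, c) erases the only off-diagonal product that would survive v_b = 0. What passes to the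
  limit is the affine identity for \<open>p\<close>: it involves only values of \<open>p\<close>, so
  no roots have to be counted in the limit.

  Rank one yields this identity because homogeneity makes s -> p (e + s x), up to sign, the reversal
  of t -> p (t e - x); one simple nonzero root of the latter leaves one linear factor in the former.
  Conversely, along an affine direction the slope alone decides whether \<open>e\<close> minus the
  direction stays in the cone, which turns the geometry of the cone into a statement about values of
  \<open>p\<close>.\<close>

section \<open>Real quadratics and real-rooted polynomials\<close>

text \<open>First-order condition: the quadratic in \<open>h\<close> has its minimum 0 at
  \<open>h = 0\<close>. It serves to put isotropic vectors of nonnegative forms into the
  kernel.\<close>

lemma linear_term_zero_if_nonneg:
  fixes b q :: real
  assumes "\<And>h. 0 \<le> 2 * h * b + h\<^sup>2 * q"
  shows "b = 0"
proof (rule ccontr)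
  assume "b \<noteq> 0"
  \<comment> \<open>Any positive \<open>r\<close> with \<open>q < 2 * r\<close> makes the quadratic
    negative at \<open>h = - b / r\<close>.\<close>
  define r where "r = 1 + \<bar>q\<bar>"
  have r: "r > 0" "q < 2 * r" unfolding r_def by auto
  have "2 * (- b / r) * b + (- b / r)\<^sup>2 * q = b\<^sup>2 * (q - 2 * r) / r\<^sup>2"
    using r by (simp add: field_simps power2_eq_square)
  also have "\<dots> < 0"
    using r \<open>b \<noteq> 0\<close> by (simp add: divide_less_0_iff mult_less_0_iff)
  finally show False using assms[of "- b / r"] by simp
qed

lemma poly_map_poly_of_real_add:
  "poly (map_poly of_real (p + q)) (z::complex) =
    poly (map_poly of_real p) z + poly (map_poly of_real q) z"
  by (subst poly_add [symmetric], rule arg_cong[where f = "\<lambda>p. poly p z"])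
     (auto intro!: poly_eqI simp: coeff_map_poly)

lemma poly_map_poly_of_real_mult:
  "poly (map_poly of_real (p * q)) (z::complex) =
    poly (map_poly of_real p) z * poly (map_poly of_real q) z"
proof (induction p)
  case (pCons a p)
  have "poly (map_poly of_real (smult a q)) z = of_real a * poly (map_poly of_real q) z"
    by (simp add: map_poly_smult)
  then show ?case
    using pCons by (simp add: poly_map_poly_of_real_add map_poly_pCons algebra_simps)
qed simp

lemma poly_map_poly_of_real_of_real:
  "poly (map_poly of_real q) (of_real t) = (of_real (poly q t) :: complex)"
  by (induction q) (simp_all add: map_poly_pCons)

text \<open>The orders are positive, so there is one nonzero root and it is simple. After dividing
  out this root and the power of t at 0, no real root remains, hence no complex one, so the quotient
  is constant.\<close>

lemma real_rooted_single_root_factorization: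
  assumes "real_rooted q" "q \<noteq> 0"
    and "(\<Sum>t | t \<noteq> 0 \<and> poly q t = 0. order t q) = 1"
  obtains c r k where "c \<noteq> 0" "\<And>t. poly q t = c * t ^ k * (t - r)"
proof -
  let ?S = "{t. t \<noteq> 0 \<and> poly q t = 0}"
  have fin: "finite ?S" by (rule finite_subset[OF _ poly_roots_finite[OF assms(2)]]) auto
  have "?S \<noteq> {}" using assms(3) by (metis sum.empty zero_neq_one)
  then obtain r where r: "r \<in> ?S" by blast
  have pos: "order t q \<ge> 1" if "t \<in> ?S" for t
    using that assms(2) order_root[of q t] by auto
  have split: "(\<Sum>t\<in>?S. order t q) = order r q + (\<Sum>t\<in>?S - {r}. order t q)"
    using fin r by (simp add: sum.remove)
  have ord: "order r q = 1" and "(\<Sum>t\<in>?S - {r}. order t q) = 0"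
    using split pos[OF r] assms(3) by auto
  then have "order t q = 0" if "t \<in> ?S - {r}" for t using fin that by simp
  then have only: "t = r" if "t \<in> ?S" for t
    using that pos[OF that] by (cases "t = r") auto
  from order_decomp[OF assms(2), of r] ord obtain q1
    where q1: "q = [:- r, 1:] * q1" "\<not> [:- r, 1:] dvd q1" by auto
  have "q1 \<noteq> 0" using q1 by auto
  from order_decomp[OF this, of 0] obtain k q2
    where q2: "q1 = [:0, 1:] ^ k * q2" "\<not> [:0, 1:] dvd q2" by auto
  have noroot: "poly q2 t \<noteq> 0" for t
  proof
    assume t: "poly q2 t = 0"
    then have "poly q t = 0" using q1 q2 by simp
    moreover have "t \<noteq> 0" using t q2(2) by (auto simp: poly_eq_0_iff_dvd)
    ultimately have "t = r" by (intro only) simp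
    then have "poly q1 r = 0" using t q2 by simp
    then show False using q1(2) by (simp add: poly_eq_0_iff_dvd)
  qed
  have "poly (map_poly of_real q2) z \<noteq> (0::complex)" for z
  proof
    assume z: "poly (map_poly of_real q2) z = (0::complex)"
    then have "poly (map_poly of_real q) z = (0::complex)"
      by (simp add: q1(1) q2(1) poly_map_poly_of_real_mult del: mult_pCons_left)
    then have "z \<in> \<real>" using assms(1) unfolding real_rooted_def by blast
    then obtain t where "z = of_real t" by (auto elim: Reals_cases)
    then show False using z noroot[of t] by (simp add: poly_map_poly_of_real_of_real)
  qed
  then have "constant (poly (map_poly of_real q2 :: complex poly))"
    using fundamental_theorem_of_algebra by blast
  then have "degree q2 = 0"
    by (metis constant_degree degree_map_poly of_real_eq_0_iff)
  then obtain c where "q2 = [:c:]" by (metis degree_eq_zeroE)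
  show ?thesis
  proof (rule that[of c k r])
    show "c \<noteq> 0" using noroot[of 0] \<open>q2 = [:c:]\<close> by simp
    show "poly q t = c * t ^ k * (t - r)" for t
      unfolding q1(1) q2(1) \<open>q2 = [:c:]\<close> poly_mult poly_power by simp
  qed
qed

text \<open>Hyperbolicity is stated for t -> p (x - t e), rank and cone for t -> p (t e - x). With -
  x in place of x in the former, the two are mirror images.\<close>

lemma real_rooted_reflect:
  assumes "\<And>t. poly q t = poly r (- t)" "real_rooted r"
  shows "real_rooted q"
proof -
  have "q = pcompose r [:0, -1:]"
    using assms(1) by (auto simp: poly_pcompose simp flip: poly_eq_poly_eq_iff)
  moreover have "poly (map_poly of_real (pcompose r [:0, -1:])) z =
      poly (map_poly of_real r) (- z)" for z :: complex
  proof (induction r)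
    case (pCons a r)
    then show ?case
      by (simp add: pcompose_pCons poly_map_poly_of_real_add poly_map_poly_of_real_mult
          map_poly_pCons del: mult_pCons_left)
  qed simp
  ultimately show ?thesis
    using assms(2) unfolding real_rooted_def by (metis Reals_minus minus_minus)
qed

section \<open>Affine directions of hyperbolic polynomials\<close>

text \<open>Inserting q(t) = c t^k (t - r) into p (e + s x) = (- s)^d q(- 1 / s) leaves a constant
  times s^(d - k - 1) (1 + s r), and the nonzero value at s = 0 forces d = k + 1. The slope is
  expressed by the value at s = 1, so that \<open>r\<close> disappears from the statement.\<close>

lemma hyperbolic_rank_one_affine:
  assumes "subspace V" "hyperbolic_on V p e" "x \<in> V" "hyperbolic_rank p e x = 1"
  shows "p (e + s *\<^sub>R x) = p e + s * (p (e + x) - p e)"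
proof -
  have pf: "real_polynomial_function p" and eV: "e \<in> V" and pe: "0 < p e"
    and rr: "\<And>x. x \<in> V \<Longrightarrow> real_rooted (line_poly p x (- e))"
    and "homogeneous_on V p"
    using assms(2) unfolding hyperbolic_on_def by auto
  then obtain d where hom: "\<And>x c. x \<in> V \<Longrightarrow> p (c *\<^sub>R x) = c ^ d * p x"
    unfolding homogeneous_on_def by blast
  define q where "q = line_poly p (- x) e"
  have q: "poly q t = p (- x + t *\<^sub>R e)" for t
    unfolding q_def by (rule poly_line_poly[OF pf])
  have "- x \<in> V" by (simp add: assms subspace_neg)
  then have "real_rooted q"
    by (intro real_rooted_reflect[OF _ rr[of "- x"]]) (simp add: q poly_line_poly[OF pf])
  define G where "G = line_poly p e x"
  have G: "poly G s = p (e + s *\<^sub>R x)" for s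
    unfolding G_def by (rule poly_line_poly[OF pf])
  have G0: "poly G 0 = p e" by (simp add: G)
  have qG: "poly G s = (- s) ^ d * poly q (- 1 / s)" if "s \<noteq> 0" for s
  proof -
    have "e + s *\<^sub>R x = (- s) *\<^sub>R (- x + (- 1 / s) *\<^sub>R e)"
      using that by (simp add: algebra_simps)
    moreover have "- x + (- 1 / s) *\<^sub>R e \<in> V"
      using assms eV by (intro subspace_add subspace_neg subspace_scale)
    ultimately show ?thesis by (simp only: G q hom)
  qed
  \<comment> \<open>Otherwise \<open>G\<close> would vanish off 0, and by continuity at 0 too, where
    its value is \<open>p e\<close>.\<close>
  have "q \<noteq> 0"
  proof
    assume "q = 0"
    then have *: "\<And>s. s \<noteq> 0 \<Longrightarrow> poly G s = 0" using qG by simp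
    have "isCont (poly G) 0" by simp
    then have "poly G \<midarrow>0\<rightarrow> poly G 0" by (simp add: isCont_def)
    moreover have "poly G \<midarrow>0\<rightarrow> 0" by (rule tendsto_eventually) (use * in \<open>auto simp: eventually_at_filter\<close>)
    ultimately show False using G0 pe LIM_unique by fastforce
  qed
  moreover have "(\<Sum>t | t \<noteq> 0 \<and> poly q t = 0. order t q) = 1"
    using assms(4) unfolding hyperbolic_rank_def q_def .
  ultimately obtain c r k where c: "c \<noteq> 0" and qf: "\<And>t. poly q t = c * t ^ k * (t - r)"
    using real_rooted_single_root_factorization \<open>real_rooted q\<close> by metis
  define C where "C = c * (- 1) ^ d * (- 1) ^ (k + 1)"
  have C: "C \<noteq> 0" using c by (simp add: C_def)
  \<comment> \<open>The factor \<open>s ^ (k + 1)\<close> clears the denominators, so that both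
    sides are polynomials in \<open>s\<close>; agreeing off 0, they coincide.\<close>
  have ev: "s ^ (k + 1) * poly G s = s ^ d * C * (1 + s * r)" if s: "s \<noteq> 0" for s
  proof -
    have "s ^ (k + 1) * poly G s = s ^ (k + 1) * ((- s) ^ d * (c * (- 1 / s) ^ k * (- 1 / s - r)))"
      using qG[OF s] by (simp only: qf)
    also have "\<dots> = (- s) ^ d * c * (s * (- 1 / s)) ^ k * (s * (- 1 / s - r))"
      by (simp only: power_mult_distrib power_add power_one_right mult_ac)
    also have "(- s) ^ d = (- 1) ^ d * s ^ d" by (rule power_minus)
    also have "s * (- 1 / s) = - 1" using s by simp
    also have "s * (- 1 / s - r) = - (1 + s * r)" using s by (simp add: field_simps)
    finally show ?thesis by (simp add: C_def algebra_simps)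
  qed
  define D where "D = monom 1 (k + 1) * G - monom 1 d * [:C, C * r:]"
  have "D = 0"
  proof (rule ccontr)
    assume "D \<noteq> 0"
    then have "finite {s. poly D s = 0}" by (rule poly_roots_finite)
    moreover have "UNIV - {0} \<subseteq> {s. poly D s = 0}"
      using ev by (auto simp: D_def poly_monom algebra_simps)
    ultimately have "finite (UNIV - {0 :: real})" by (rule rev_finite_subset)
    then show False by (simp add: infinite_UNIV_char_0)
  qed
  then have eq: "monom 1 (k + 1) * G = monom 1 d * [:C, C * r:]" by (simp add: D_def)
  have "coeff G 0 \<noteq> 0" using G0 pe by (simp add: poly_0_coeff_0)
  \<comment> \<open>Compare lowest terms: \<open>G\<close> has nonzero constant term and
    \<open>C\<close> is nonzero, so the two sides of \<open>eq\<close> start in degrees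
    \<open>k + 1\<close> and \<open>d\<close>.\<close>
  have "k + 1 = d"
  proof (rule linorder_cases)
    assume "k + 1 < d"
    moreover have "coeff (monom 1 (k + 1) * G) (k + 1) = coeff G 0"
      by (simp add: coeff_monom_mult)
    ultimately show ?thesis using \<open>coeff G 0 \<noteq> 0\<close> unfolding eq by (simp add: coeff_monom_mult)
  next
    assume "d < k + 1"
    moreover have "coeff (monom 1 (k + 1) * G) d = C"
      unfolding eq by (simp add: coeff_monom_mult del: mult_pCons_right)
    ultimately show ?thesis using C by (simp add: coeff_monom_mult)
  qed
  then have "G = [:C, C * r:]"
    using eq by (simp add: monom_eq_0_iff del: mult_pCons_right)
  then have "poly G s = C + s * (C * r)" for s by simp
  then have lin: "p (e + s *\<^sub>R x) = C + s * (C * r)" for s by (simp only: G)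
  have "p e = C" "p (e + x) = C + C * r" using lin[of 0] lin[of 1] by simp_all
  then show ?thesis by (simp add: lin)
qed

text \<open>Up to the factor \<open>p e\<close>, p ((t - 1) e + x) is (t - 1)^d (1 + m / (t - 1))
  for t other than 1, where m is the relative slope; so the only root besides possibly 1 is 1 - m.
  Affinity rather than rank one is assumed because the criterion is applied to limits of rank-one
  elements.\<close>

lemma affine_direction_in_cone_iff:
  assumes "subspace V" "hyperbolic_on V p e" "x \<in> V"
    and aff: "\<And>s. p (e + s *\<^sub>R x) = p e + s * (p (e + x) - p e)"
  shows "e - x \<in> hyperbolicity_cone V p e \<longleftrightarrow> p (e + x) / p e - 1 \<le> 1"
proof -
  have pf: "real_polynomial_function p" and eV: "e \<in> V" and pe: "0 < p e"
    and "homogeneous_on V p"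
    using assms(2) unfolding hyperbolic_on_def by auto
  then obtain d where hom: "\<And>x c. x \<in> V \<Longrightarrow> p (c *\<^sub>R x) = c ^ d * p x"
    unfolding homogeneous_on_def by blast
  define m where "m = p (e + x) / p e - 1"
  have m: "p (e + x) - p e = p e * m" using pe by (simp add: m_def field_simps)
  have root: "p (- (e - x) + t *\<^sub>R e) = 0 \<longleftrightarrow> t = 1 - m" if "t \<noteq> 1" for t
  proof -
    let ?u = "t - 1"
    have u: "?u \<noteq> 0" using that by simp
    have "- (e - x) + t *\<^sub>R e = ?u *\<^sub>R (e + (1 / ?u) *\<^sub>R x)"
      using u by (simp add: algebra_simps)
    moreover have "e + (1 / ?u) *\<^sub>R x \<in> V"
      using assms eV by (intro subspace_add subspace_scale)
    ultimately have "p (- (e - x) + t *\<^sub>R e) = ?u ^ d * (p e + (1 / ?u) * (p e * m))"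
      by (simp only: hom aff[of "1 / ?u"] m)
    also have "\<dots> = ?u ^ d * p e * ((?u + m) / ?u)" using u by (simp add: field_simps)
    finally show ?thesis using u pe by auto
  qed
  have "e - x \<in> V" using assms eV by (intro subspace_diff)
  then have "e - x \<in> hyperbolicity_cone V p e \<longleftrightarrow> (\<forall>t. p (- (e - x) + t *\<^sub>R e) = 0 \<longrightarrow> 0 \<le> t)"
    by (simp only: hyperbolicity_cone_def mem_Collect_eq poly_line_poly[OF pf] simp_thms)
  also have "\<dots> \<longleftrightarrow> m \<le> 1"
  proof
    assume *: "\<forall>t. p (- (e - x) + t *\<^sub>R e) = 0 \<longrightarrow> 0 \<le> t"
    show "m \<le> 1"
    \<comment> \<open>For \<open>m = 0\<close> the candidate root \<open>1 - m\<close> is 1, which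
      \<open>root\<close> excludes.\<close>
    proof (cases "m = 0")
      case False
      then have "p (- (e - x) + (1 - m) *\<^sub>R e) = 0" by (subst root) auto
      then show ?thesis using * by (metis diff_ge_0_iff_ge)
    qed simp
  next
    assume "m \<le> 1"
    then show "\<forall>t. p (- (e - x) + t *\<^sub>R e) = 0 \<longrightarrow> 0 \<le> t"
      using root by (metis diff_ge_0_iff_ge zero_le_one)
  qed
  finally show ?thesis unfolding m_def .
qed

section \<open>Graph cones and their 2 x 2 blocks\<close>

lemma subspace_graph_matrices: "subspace (graph_matrices E)"
  by (auto simp: subspace_def graph_matrices_def transpose_def vec_eq_iff)

lemma graph_cone_sym: "X \<in> graph_cone E \<Longrightarrow> X $ i $ j = X $ j $ i"
  by (auto simp: graph_cone_def graph_matrices_def transpose_def vec_eq_iff)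

lemma graph_cone_diag_nonneg: "X \<in> graph_cone E \<Longrightarrow> 0 \<le> X $ i $ i"
proof -
  assume "X \<in> graph_cone E"
  moreover have "clique {i} E" by (simp add: clique_def)
  ultimately have "psd_submatrix {i} X" by (simp add: graph_cone_def)
  then show ?thesis unfolding psd_submatrix_def by (drule_tac x = "\<lambda>_. 1" in spec) simp
qed

lemma graph_cone_edge_nonneg:
  assumes "X \<in> graph_cone E" "{i, j} \<in> E" "i \<noteq> j"
  shows "0 \<le> x\<^sup>2 * X $ i $ i + 2 * x * y * X $ i $ j + y\<^sup>2 * X $ j $ j"
proof -
  have "clique {i, j} E" using assms by (auto simp: clique_def insert_commute)
  then have "psd_submatrix {i, j} X" using assms by (auto simp: graph_cone_def)
  then have "0 \<le> (\<Sum>k\<in>{i, j}. \<Sum>l\<in>{i, j}. (if k = i then x else y) * X $ k $ l * (if l = i then x else y))"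
    unfolding psd_submatrix_def by (rule spec)
  then show ?thesis
    using assms(3) graph_cone_sym[OF assms(1), of i j]
    by (simp add: algebra_simps power2_eq_square)
qed

text \<open>A nonnegative form vanishing at a vector is minimal there; varying one coordinate at a
  time gives the two kernel equations.\<close>

lemma graph_cone_edge_isotropic:
  assumes "X \<in> graph_cone E" "{i, j} \<in> E" "i \<noteq> j"
    and "x\<^sup>2 * X $ i $ i + 2 * x * y * X $ i $ j + y\<^sup>2 * X $ j $ j = 0"
  shows "x * X $ i $ i + y * X $ i $ j = 0" "x * X $ i $ j + y * X $ j $ j = 0"
proof -
  have "0 \<le> 2 * h * (x * X $ i $ i + y * X $ i $ j) + h\<^sup>2 * X $ i $ i" for h
    using graph_cone_edge_nonneg[OF assms(1-3), of "x + h" y] assms(4)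
    by (simp add: algebra_simps power2_eq_square)
  then show "x * X $ i $ i + y * X $ i $ j = 0" by (rule linear_term_zero_if_nonneg)
  have "0 \<le> 2 * h * (x * X $ i $ j + y * X $ j $ j) + h\<^sup>2 * X $ j $ j" for h
    using graph_cone_edge_nonneg[OF assms(1-3), of x "y + h"] assms(4)
    by (simp add: algebra_simps power2_eq_square)
  then show "x * X $ i $ j + y * X $ j $ j = 0" by (rule linear_term_zero_if_nonneg)
qed

lemma graph_cone_zero_diag:
  assumes "X \<in> graph_cone E" "X $ i $ i = 0"
  shows "X $ i $ j = 0"
proof (cases "i = j \<or> {i, j} \<notin> E")
  case True
  then show ?thesis
    using assms by (cases "i = j") (auto simp: graph_cone_def graph_matrices_def)
next
  case False
  then show ?thesis using graph_cone_edge_isotropic(2)[of X E i j 1 0] assms by simp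
qed

lemma graph_cone_scaleR:
  assumes "X \<in> graph_cone E" "0 \<le> c"
  shows "c *\<^sub>R X \<in> graph_cone E"
proof -
  have "psd_submatrix C (c *\<^sub>R X)" if "psd_submatrix C X" for C
    unfolding psd_submatrix_def
  proof
    fix x
    have "(\<Sum>i\<in>C. \<Sum>j\<in>C. x i * (c *\<^sub>R X) $ i $ j * x j) =
        c * (\<Sum>i\<in>C. \<Sum>j\<in>C. x i * X $ i $ j * x j)"
      by (simp add: sum_distrib_left mult_ac)
    then show "0 \<le> (\<Sum>i\<in>C. \<Sum>j\<in>C. x i * (c *\<^sub>R X) $ i $ j * x j)"
      using that assms(2) by (simp add: psd_submatrix_def)
  qed
  then show ?thesis
    using assms(1) subspace_scale[OF subspace_graph_matrices] by (auto simp: graph_cone_def)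
qed

lemma cone_hull_singleton: "cone hull {x} = {k *\<^sub>R x | k. 0 \<le> k}"
  by (auto simp: cone_hull_expl)

section \<open>Extreme rays supported on an induced path\<close>

text \<open>Comparing unordered pairs treats the entries (a, c) and (c, a) at once. If
  \<open>v\<close> is supported on a, b, c and \<open>v b = 0\<close>, the matrix is
  diagonal.\<close>

definition path_matrix :: "'n::finite \<Rightarrow> 'n \<Rightarrow> ('n \<Rightarrow> real) \<Rightarrow> real^'n^'n" where
  "path_matrix a c v = (\<chi> i j. if {i, j} = {a, c} then 0 else v i * v j)"

text \<open>No clique contains both \<open>a\<close> and \<open>c\<close>, so on each clique the
  matrix agrees with v v^T, whose form is a square.\<close>

lemma path_matrix_in_graph_cone:
  assumes "{a, b} \<in> E" "{b, c} \<in> E" "{a, c} \<notin> E" "a \<noteq> c"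
    and v: "\<And>i. i \<notin> {a, b, c} \<Longrightarrow> v i = 0"
  shows "path_matrix a c v \<in> graph_cone E"
proof -
  have "psd_submatrix C (path_matrix a c v)" if C: "clique C E" for C
    unfolding psd_submatrix_def
  proof
    fix x
    have "\<not> (a \<in> C \<and> c \<in> C)" using C assms(3,4) by (auto simp: clique_def)
    then have "path_matrix a c v $ i $ j = v i * v j" if "i \<in> C" "j \<in> C" for i j
      using that by (auto simp: path_matrix_def doubleton_eq_iff)
    then have "(\<Sum>i\<in>C. \<Sum>j\<in>C. x i * path_matrix a c v $ i $ j * x j) =
        (\<Sum>i\<in>C. x i * v i)\<^sup>2"
      by (simp add: power2_eq_square sum_product mult_ac)
    then show "0 \<le> (\<Sum>i\<in>C. \<Sum>j\<in>C. x i * path_matrix a c v $ i $ j * x j)" by simp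
  qed
  moreover have "path_matrix a c v \<in> graph_matrices E"
    unfolding graph_matrices_def mem_Collect_eq
  proof (intro conjI allI impI)
    show "transpose (path_matrix a c v) = path_matrix a c v"
      by (simp add: transpose_def path_matrix_def vec_eq_iff insert_commute mult.commute)
    fix i j assume ij: "i \<noteq> j \<and> {i, j} \<notin> E"
    show "path_matrix a c v $ i $ j = 0"
    proof (cases "{i, j} = {a, c}")
      case False
      then have "i \<notin> {a, b, c} \<or> j \<notin> {a, b, c}"
        using ij assms(1,2) by (auto simp: insert_commute)
      then show ?thesis using v by (auto simp: path_matrix_def)
    qed (simp add: path_matrix_def)
  qed
  ultimately show ?thesis by (auto simp: graph_cone_def)
qed

text \<open>On an edge {i, b} the block of v v^T has an isotropic vector. It is isotropic for the
  nonnegative blocks of both summands, hence in the kernel of the block of \<open>X\<close>. As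
  \<open>v b\<close> is nonzero, this expresses the entries of \<open>X\<close> at \<open>i\<close>
  through \<open>X $ b $ b\<close>. The pair (a, c), not reached this way, carries a zero entry in
  the whole space.\<close>

lemma path_matrix_summand:
  assumes ab: "{a, b} \<in> E" and bc: "{b, c} \<in> E" and ac: "{a, c} \<notin> E"
    and ne: "a \<noteq> b" "b \<noteq> c" "a \<noteq> c"
    and v: "\<And>i. i \<notin> {a, b, c} \<Longrightarrow> v i = 0" and "v b \<noteq> 0"
    and X: "X \<in> graph_cone E" and Y: "Y \<in> graph_cone E"
    and sum: "X + Y = k *\<^sub>R path_matrix a c v"
  shows "X \<in> cone hull {path_matrix a c v}"
proof -
  have XY: "X $ i $ j + Y $ i $ j = k * (if {i, j} = {a, c} then 0 else v i * v j)" for i j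
    using sum by (simp add: vec_eq_iff path_matrix_def)
  define s where "s = X $ b $ b / (v b)\<^sup>2"
  have Xbb: "X $ b $ b = s * (v b)\<^sup>2" using \<open>v b \<noteq> 0\<close> by (simp add: s_def)
  have s0: "0 \<le> s" using graph_cone_diag_nonneg[OF X, of b] by (simp add: s_def)
  have edge: "X $ i $ b = s * v i * v b \<and> X $ i $ i = s * (v i)\<^sup>2"
    if i: "{i, b} \<in> E" "i \<noteq> b" "i \<in> {a, c}" for i
  proof -
    \<comment> \<open>The form of the {i, b} block at the vector with entries \<open>v b\<close> at
      \<open>i\<close> and \<open>- v i\<close> at \<open>b\<close>, where (v_i v_b - v_b v_i)^2 =
      0.\<close>
    let ?Q = "\<lambda>X. (v b)\<^sup>2 * X $ i $ i + 2 * v b * (- v i) * X $ i $ b + (- v i)\<^sup>2 * X $ b $ b"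
    have "?Q X + ?Q Y = (v b)\<^sup>2 * (X $ i $ i + Y $ i $ i)
        + 2 * v b * (- v i) * (X $ i $ b + Y $ i $ b) + (- v i)\<^sup>2 * (X $ b $ b + Y $ b $ b)"
      by (simp add: algebra_simps)
    also have "\<dots> = 0"
      using i ne unfolding XY by (auto simp: doubleton_eq_iff power2_eq_square)
    finally have "?Q X + ?Q Y = 0" .
    moreover have "0 \<le> ?Q X" by (rule graph_cone_edge_nonneg[OF X i(1,2)])
    moreover have "0 \<le> ?Q Y" by (rule graph_cone_edge_nonneg[OF Y i(1,2)])
    ultimately have "?Q X = 0" by linarith
    note this[THEN graph_cone_edge_isotropic(1)[OF X i(1,2)]]
      this[THEN graph_cone_edge_isotropic(2)[OF X i(1,2)]]
    then have e1: "v b * X $ i $ i = v i * X $ i $ b" and e2: "v b * X $ i $ b = v i * X $ b $ b"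
      by auto
    have "v b * X $ i $ b = v b * (s * v i * v b)"
      unfolding e2 Xbb by (simp add: power2_eq_square)
    then have ib: "X $ i $ b = s * v i * v b" using \<open>v b \<noteq> 0\<close> by simp
    have "v b * X $ i $ i = v b * (s * (v i)\<^sup>2)"
      unfolding e1 ib by (simp add: power2_eq_square)
    then have "X $ i $ i = s * (v i)\<^sup>2" using \<open>v b \<noteq> 0\<close> by simp
    then show ?thesis using ib by blast
  qed
  have ea: "X $ a $ b = s * v a * v b" "X $ a $ a = s * (v a)\<^sup>2"
    and ec: "X $ c $ b = s * v c * v b" "X $ c $ c = s * (v c)\<^sup>2"
    using edge[of a] edge[of c] ab bc ne by (auto simp: insert_commute)
  have out: "X $ i $ j = 0" if "i \<notin> {a, b, c}" for i j
  proof -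
    have "X $ i $ i + Y $ i $ i = 0" using XY[of i i] v[OF that] by simp
    then have "X $ i $ i = 0"
      using graph_cone_diag_nonneg[OF X, of i] graph_cone_diag_nonneg[OF Y, of i] by simp
    then show ?thesis by (rule graph_cone_zero_diag[OF X])
  qed
  have Xac: "X $ a $ c = 0" using X ac ne by (auto simp: graph_cone_def graph_matrices_def)
  have "X = s *\<^sub>R path_matrix a c v"
  proof -
    have "X $ i $ j = s * path_matrix a c v $ i $ j" for i j
    proof (cases "i \<in> {a, b, c} \<and> j \<in> {a, b, c}")
      case True
      note sy = graph_cone_sym[OF X]
      show ?thesis
        using True ne ea ec Xac Xbb sy[of b a] sy[of b c] sy[of c a]
        by (auto simp: path_matrix_def doubleton_eq_iff power2_eq_square)
    next
      case False
      then show ?thesis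
        using out[of i j] out[of j i] graph_cone_sym[OF X, of i j] v
        by (auto simp: path_matrix_def)
    qed
    then show ?thesis by (simp add: vec_eq_iff)
  qed
  then show ?thesis using s0 by (auto simp: cone_hull_singleton)
qed

text \<open>In a cone the weights of a convex combination can be absorbed into its endpoints, so
  \<open>path_matrix_summand\<close> applies to both of them.\<close>

lemma extreme_ray_path_matrix:
  assumes g: "{a, b} \<in> E" "{b, c} \<in> E" "{a, c} \<notin> E" "a \<noteq> b" "b \<noteq> c" "a \<noteq> c"
    and v: "\<And>i. i \<notin> {a, b, c} \<Longrightarrow> v i = 0" "v b \<noteq> 0"
  shows "extreme_ray (cone hull {path_matrix a c v}) (graph_cone E)"
proof -
  let ?M = "path_matrix a c v"
  have M: "?M \<in> graph_cone E" using g v by (intro path_matrix_in_graph_cone) auto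
  have "?M $ b $ b \<noteq> 0" using g v(2) by (auto simp: path_matrix_def doubleton_eq_iff)
  then have "?M \<noteq> 0" by auto
  moreover have "cone hull {?M} face_of graph_cone E"
    unfolding face_of_def
  proof (intro conjI ballI impI)
    show "cone hull {?M} \<subseteq> graph_cone E"
      using graph_cone_scaleR[OF M] by (auto simp: cone_hull_singleton)
    show "convex (cone hull {?M})" by (simp add: convex_cone_hull)
    fix A B x
    assume AB: "A \<in> graph_cone E" "B \<in> graph_cone E" and x: "x \<in> cone hull {?M}"
      and seg: "x \<in> open_segment A B"
    obtain k where k: "x = k *\<^sub>R ?M" using x by (auto simp: cone_hull_singleton)
    obtain u where u: "0 < u" "u < 1" "x = (1 - u) *\<^sub>R A + u *\<^sub>R B"
      using seg by (auto simp: in_segment)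
    have cA: "(1 - u) *\<^sub>R A \<in> graph_cone E" and cB: "u *\<^sub>R B \<in> graph_cone E"
      using AB u by (auto intro: graph_cone_scaleR)
    have *: "Z \<in> cone hull {?M}" if Z: "r *\<^sub>R Z \<in> cone hull {?M}" "r > 0" for r Z
    proof -
      obtain h where "r *\<^sub>R Z = h *\<^sub>R ?M" "0 \<le> h" using Z by (auto simp: cone_hull_singleton)
      then have "Z = (h / r) *\<^sub>R ?M" "0 \<le> h / r"
        using Z(2) by (auto simp: eq_vector_fraction_iff)
      then show ?thesis unfolding cone_hull_singleton by blast
    qed
    have "(1 - u) *\<^sub>R A \<in> cone hull {?M}"
      by (rule path_matrix_summand[of a b E c v _ "u *\<^sub>R B" k])
        (use g v cA cB u(3) k in auto)
    then show "A \<in> cone hull {?M}" using * u by simp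
    have "u *\<^sub>R B \<in> cone hull {?M}"
      by (rule path_matrix_summand[of a b E c v _ "(1 - u) *\<^sub>R A" k])
        (use g v cA cB u(3) k in \<open>auto simp: add.commute\<close>)
    then show "B \<in> cone hull {?M}" using * u by simp
  qed
  ultimately show ?thesis unfolding extreme_ray_def by blast
qed

section \<open>Transitive adjacency and induced paths\<close>

lemma transitive_imp_component_edge:
  assumes "\<And>a b c. {a, b} \<in> E \<Longrightarrow> {b, c} \<in> E \<Longrightarrow> a \<noteq> c \<Longrightarrow> {a, c} \<in> E"
    and "w \<in> component_of_vertex E v"
  shows "w = v \<or> {v, w} \<in> E"
proof -
  have "(v, w) \<in> {(u, w). {u, w} \<in> E}\<^sup>*" using assms(2) by (simp add: component_of_vertex_def)
  then show ?thesis
  proof induction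
    case (step y z)
    then show ?case using assms(1)[of v y z] by auto
  qed simp
qed

lemma not_disjoint_union_of_cliques_obtain_path:
  assumes "simple_graph E" "\<not> disjoint_union_of_cliques E"
  obtains a b c where "{a, b} \<in> E" "{b, c} \<in> E" "{a, c} \<notin> E" "a \<noteq> b" "b \<noteq> c" "a \<noteq> c"
proof (rule ccontr)
  assume "\<not> thesis"
  with that have tr: "{a, c} \<in> E" if "{a, b} \<in> E" "{b, c} \<in> E" "a \<noteq> c" for a b c
    using that by (cases "a = b \<or> b = c") auto
  have "clique (component_of_vertex E v) E" for v
    unfolding clique_def
  proof (intro ballI impI)
    fix u w assume uw: "u \<in> component_of_vertex E v" "w \<in> component_of_vertex E v" "u \<noteq> w"
    have "u = v \<or> {v, u} \<in> E" "w = v \<or> {v, w} \<in> E"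
      using transitive_imp_component_edge[of E] tr uw by metis+
    then show "{u, w} \<in> E" using tr[of u v w] uw(3) by (auto simp: insert_commute)
  qed
  then show False using assms(2) by (simp add: disjoint_union_of_cliques_def)
qed

section \<open>Obstruction from an induced path\<close>

definition diag_pair :: "'n::finite \<Rightarrow> 'n \<Rightarrow> real \<Rightarrow> real \<Rightarrow> real^'n^'n" where
  "diag_pair a c x y = (\<chi> i j. if i = j then (if i = a then x else if i = c then y else 0) else 0)"

lemma diag_pair_in_graph_matrices: "diag_pair a c x y \<in> graph_matrices E"
  by (auto simp: diag_pair_def graph_matrices_def transpose_def vec_eq_iff)

lemma scaleR_diag_pair: "s *\<^sub>R diag_pair a c x y = diag_pair a c (s * x) (s * y)"
  by (auto simp: diag_pair_def vec_eq_iff)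

lemma diag_pair_add: "diag_pair a c x y + diag_pair a c x' y' = diag_pair a c (x + x') (y + y')"
  by (auto simp: diag_pair_def vec_eq_iff)

text \<open>The zero direction is affine with slope 0.\<close>

lemma hyperbolicity_cone_direction:
  assumes "subspace V" "hyperbolic_on V p e"
  shows "e \<in> hyperbolicity_cone V p e"
  using affine_direction_in_cone_iff[OF assms subspace_0[OF assms(1)]] assms(2)
  by (simp add: hyperbolic_on_def)

text \<open>
  No clique contains both \<open>a\<close> and \<open>c\<close>, so every clique submatrix of \<open>X - diag_pair a c x y\<close>
  is one of \<open>X - diag_pair a c x 0\<close> or of \<open>X - diag_pair a c 0 y\<close>.
\<close>

lemma graph_cone_diff_diag_pair:
  assumes X: "X \<in> graph_cone E" and ac: "{a, c} \<notin> E" "a \<noteq> c"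
  shows "X - diag_pair a c x y \<in> graph_cone E \<longleftrightarrow>
    X - diag_pair a c x 0 \<in> graph_cone E \<and> X - diag_pair a c 0 y \<in> graph_cone E"
proof -
  have V: "X - diag_pair a c x y \<in> graph_matrices E" for x y
    using X by (auto intro: subspace_diff[OF subspace_graph_matrices] diag_pair_in_graph_matrices
        simp: graph_cone_def)
  have cong: "psd_submatrix C A \<longleftrightarrow> psd_submatrix C B"
    if "\<And>i j. i \<in> C \<Longrightarrow> j \<in> C \<Longrightarrow> A $ i $ j = B $ i $ j" for C and A B :: "real^'a^'a"
    unfolding psd_submatrix_def using that by simp
  have A: "psd_submatrix C (X - diag_pair a c x y) \<longleftrightarrow> psd_submatrix C (X - diag_pair a c 0 y)"
    if "a \<notin> C" for C x y
    using that by (intro cong) (auto simp: diag_pair_def)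
  have B: "psd_submatrix C (X - diag_pair a c x y) \<longleftrightarrow> psd_submatrix C (X - diag_pair a c x 0)"
    if "c \<notin> C" for C x y
    using that by (intro cong) (auto simp: diag_pair_def)
  have zero: "X - diag_pair a c 0 0 = X" by (simp add: diag_pair_def vec_eq_iff)
  have "psd_submatrix C (X - diag_pair a c x y) \<longleftrightarrow>
      psd_submatrix C (X - diag_pair a c x 0) \<and> psd_submatrix C (X - diag_pair a c 0 y)"
    if C: "clique C E" for C
  proof -
    have psd: "psd_submatrix C X" using X C by (simp add: graph_cone_def)
    have "a \<notin> C \<or> c \<notin> C" using C ac by (auto simp: clique_def)
    \<comment> \<open>If \<open>a\<close> is not in \<open>C\<close>, the block with parameters
      \<open>x\<close> and 0 is that of \<open>X\<close> itself, so this conjunct holds for free;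
      likewise for \<open>c\<close> and the other conjunct.\<close>
    then show ?thesis
      using A[of C x y] A[of C x 0] B[of C x y] B[of C 0 y] psd zero by auto
  qed
  then show ?thesis using V unfolding graph_cone_def by blast
qed

text \<open>Rank one is only given for some generator of the ray. Affinity carries over to its
  multiples, so the rank of the path matrix itself need not be computed.\<close>

lemma ROG_path_matrix_affine:
  assumes g: "{a, b} \<in> E" "{b, c} \<in> E" "{a, c} \<notin> E" "a \<noteq> b" "b \<noteq> c" "a \<noteq> c"
    and v: "\<And>i. i \<notin> {a, b, c} \<Longrightarrow> v i = 0" "v b \<noteq> 0"
    and hyp: "hyperbolic_on (graph_matrices E) p e"
    and K: "graph_cone E = hyperbolicity_cone (graph_matrices E) p e"
    and rog: "rank_one_generated (graph_matrices E) p e"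
  shows "p (e + s *\<^sub>R path_matrix a c v) = p e + s * (p (e + path_matrix a c v) - p e)"
proof -
  let ?M = "path_matrix a c v"
  have ext: "extreme_ray (cone hull {?M}) (graph_cone E)"
    using g v by (intro extreme_ray_path_matrix) auto
  then obtain x where x: "hyperbolic_rank p e x = 1" and hull: "cone hull {?M} = cone hull {x}"
    using rog unfolding rank_one_generated_def K by blast
  have "x \<in> cone hull {?M}" unfolding hull by (simp add: hull_inc)
  then have "x \<in> graph_cone E" using ext face_of_imp_subset unfolding extreme_ray_def by blast
  then have xV: "x \<in> graph_matrices E" by (simp add: graph_cone_def)
  have "?M \<in> cone hull {x}" unfolding hull[symmetric] by (simp add: hull_inc)
  then obtain k where k: "?M = k *\<^sub>R x" by (auto simp: cone_hull_singleton)
  have aff: "p (e + (s * k) *\<^sub>R x) = p e + (s * k) * (p (e + x) - p e)" for s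
    by (rule hyperbolic_rank_one_affine[OF subspace_graph_matrices hyp xV x])
  show ?thesis using aff[of s] aff[of 1] by (simp add: k)
qed

lemma ROG_diag_pair_affine:
  assumes g: "{a, b} \<in> E" "{b, c} \<in> E" "{a, c} \<notin> E" "a \<noteq> b" "b \<noteq> c" "a \<noteq> c"
    and hyp: "hyperbolic_on (graph_matrices E) p e"
    and K: "graph_cone E = hyperbolicity_cone (graph_matrices E) p e"
    and rog: "rank_one_generated (graph_matrices E) p e"
    and "0 \<le> x" "0 \<le> y"
  shows "p (e + s *\<^sub>R diag_pair a c x y) = p e + s * (p (e + diag_pair a c x y) - p e)"
proof -
  \<comment> \<open>The diagonal entries of \<open>path_matrix\<close> are squares, whence the
    roots; \<open>h\<close> is the entry at \<open>b\<close> that tends to 0.\<close>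
  define v where "v = (\<lambda>h. (\<lambda>_. 0)(a := sqrt x, b := h, c := sqrt y))"
  define M where "M = (\<lambda>h. path_matrix a c (v h))"
  define f where "f = (\<lambda>h. p (e + s *\<^sub>R M h) - (p e + s * (p (e + M h) - p e)))"
  have cv: "continuous_on UNIV (\<lambda>h. v h i)" for i
    by (cases "i = c"; cases "i = b"; cases "i = a") (simp_all add: v_def)
  have cM: "continuous_on UNIV M"
    unfolding M_def path_matrix_def
  proof (intro continuous_on_vec_lambda)
    fix i j
    show "continuous_on UNIV (\<lambda>h. if {i, j} = {a, c} then 0 else v h i * v h j)"
      by (cases "{i, j} = {a, c}") (simp_all add: cv continuous_on_mult)
  qed
  have "isCont p z" for z
    using hyp by (simp add: hyperbolic_on_def continuous_real_polymonial_function)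
  then have "continuous_on UNIV p" by (simp add: continuous_at_imp_continuous_on)
  then have cp: "continuous_on UNIV (\<lambda>h. p (g h))" if "continuous_on UNIV g" for g :: "real \<Rightarrow> _"
    using that by (rule continuous_on_compose2) simp
  have "continuous_on UNIV f"
    unfolding f_def by (intro continuous_intros cp cM)
  then have "f \<midarrow>0\<rightarrow> f 0" by (simp add: continuous_on_eq_continuous_at isCont_def)
  moreover have "f h = 0" if "h \<noteq> 0" for h
  proof -
    have "p (e + s *\<^sub>R M h) = p e + s * (p (e + M h) - p e)"
      unfolding M_def
      by (rule ROG_path_matrix_affine[OF g _ _ hyp K rog]) (use that g in \<open>auto simp: v_def\<close>)
    then show ?thesis by (simp add: f_def)
  qed
  then have "f \<midarrow>0\<rightarrow> 0" by (intro tendsto_eventually) (auto simp: eventually_at_filter)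
  ultimately have "f 0 = 0" using LIM_unique by blast
  moreover have "M 0 = diag_pair a c x y"
    using g assms(10,11)
    by (auto simp: M_def path_matrix_def diag_pair_def v_def vec_eq_iff doubleton_eq_iff)
  ultimately show ?thesis by (simp add: f_def)
qed

text \<open>
  With \<open>m x y = p (e + diag_pair a c x y) / p e - 1\<close>, the element \<open>e - diag_pair a c x y\<close> lies in
  the cone iff \<open>m x y \<le> 1\<close>, hence iff \<open>m x 0 \<le> 1\<close> and \<open>m 0 y \<le> 1\<close>. By homogeneity \<open>m\<close> is then the
  maximum of two positive linear forms in \<open>x\<close> and \<open>y\<close>, which is not a polynomial.
\<close>

lemma not_ROG_realizable_if_path:
  assumes g: "{a, b} \<in> E" "{b, c} \<in> E" "{a, c} \<notin> E" "a \<noteq> b" "b \<noteq> c" "a \<noteq> c"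
  shows "\<not> ROG_realizable (graph_matrices E) (graph_cone E)"
proof
  assume "ROG_realizable (graph_matrices E) (graph_cone E)"
  then obtain p e where hyp: "hyperbolic_on (graph_matrices E) p e"
    and K: "graph_cone E = hyperbolicity_cone (graph_matrices E) p e"
    and rog: "rank_one_generated (graph_matrices E) p e"
    unfolding ROG_realizable_def by blast
  have pf: "real_polynomial_function p" and pe: "0 < p e"
    using hyp by (auto simp: hyperbolic_on_def)
  have eK: "e \<in> graph_cone E"
    unfolding K by (rule hyperbolicity_cone_direction[OF subspace_graph_matrices hyp])
  define m where "m x y = p (e + diag_pair a c x y) / p e - 1" for x y
  note aff = ROG_diag_pair_affine[OF g hyp K rog]
  have cone: "e - diag_pair a c x y \<in> graph_cone E \<longleftrightarrow> m x y \<le> 1" if "0 \<le> x" "0 \<le> y" for x y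
    unfolding K m_def
    by (rule affine_direction_in_cone_iff[OF subspace_graph_matrices hyp
          diag_pair_in_graph_matrices aff[OF that]])
  have hom: "m (s * x) (s * y) = s * m x y" if "0 \<le> x" "0 \<le> y" for s x y
    using aff[OF that, of s] pe by (simp add: m_def scaleR_diag_pair field_simps)
  have max: "m x y \<le> 1 \<longleftrightarrow> m x 0 \<le> 1 \<and> m 0 y \<le> 1" if "0 \<le> x" "0 \<le> y" for x y
    using graph_cone_diff_diag_pair[OF eK g(3,6), of x y] cone[OF that] cone[of x 0] cone[of 0 y] that
    by simp
  have pos: "0 < m x y" if xy: "0 \<le> x" "0 \<le> y" and i: "diag_pair a c x y $ i $ i = 1" for x y i
  proof (rule ccontr)
    assume "\<not> 0 < m x y"
    \<comment> \<open>Chosen so that the entry at (i, i) of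
      \<open>e - s *\<^sub>R diag_pair a c x y\<close> is - 1.\<close>
    define s where "s = e $ i $ i + 1"
    have s: "0 \<le> s" using graph_cone_diag_nonneg[OF eK, of i] by (simp add: s_def)
    then have "m (s * x) (s * y) \<le> 1"
      using \<open>\<not> 0 < m x y\<close> hom[OF xy, of s] mult_nonneg_nonpos[of s "m x y"] by simp
    then have "e - s *\<^sub>R diag_pair a c x y \<in> graph_cone E"
      using cone[of "s * x" "s * y"] s xy by (simp add: scaleR_diag_pair)
    from graph_cone_diag_nonneg[OF this, of i] show False using i by (simp add: s_def)
  qed
  have l: "0 < m 1 0" by (rule pos[of _ _ a]) (simp_all add: diag_pair_def)
  define w where "w = m 0 1"
  have r: "0 < w" unfolding w_def by (rule pos[of _ _ c]) (use g in \<open>simp_all add: diag_pair_def\<close>)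
  \<comment> \<open>Normalized so that the first form equals 1 at \<open>x0\<close>; the second
    reaches 1 at \<open>1 / w\<close>, and up to there the first dominates.\<close>
  define x0 where "x0 = 1 / m 1 0"
  have x0: "0 < x0" using l by (simp add: x0_def)
  have mx: "m (s * x0) 0 = s" if "0 \<le> s" for s
    using hom[of 1 0 "s * x0"] l by (simp add: x0_def)
  have my: "m 0 y = y * w" for y using hom[of 0 1 y] by (simp add: w_def)
  have one: "m x0 y = 1" if y: "0 \<le> y" "y \<le> 1 / w" for y
  proof (rule antisym)
    have "m 0 y \<le> 1" using y r by (simp add: my field_simps)
    then show "m x0 y \<le> 1" using max[of x0 y] mx[of 1] x0 y by simp
    \<comment> \<open>After scaling by \<open>s\<close> the first form has the value
      \<open>s\<close>, which the cone condition bounds by 1.\<close>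
    have sle: "s \<le> 1" if "s * m x0 y \<le> 1" "0 \<le> s" for s
      using max[of "s * x0" "s * y"] hom[of x0 y s] mx[of s] x0 y that by simp
    show "1 \<le> m x0 y"
    \<comment> \<open>A nonpositive value would admit every nonnegative \<open>s\<close>, for
      instance 2; a positive one admits its reciprocal.\<close>
    proof (cases "m x0 y \<le> 0")
      case True
      then show ?thesis using sle[of 2] by simp
    next
      case False
      then show ?thesis using sle[of "1 / m x0 y"] by simp
    qed
  qed
  define q where "q = line_poly p (e + diag_pair a c x0 0) (diag_pair a c 0 1) - [:2 * p e:]"
  have q: "poly q y = p e * (m x0 y - 1)" for y
    using pe by (simp add: q_def poly_line_poly[OF pf] m_def scaleR_diag_pair diag_pair_add
        add.assoc field_simps)
  have "q = 0"
  proof (rule ccontr)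
    assume "q \<noteq> 0"
    then have "finite {y. poly q y = 0}" by (rule poly_roots_finite)
    moreover have "{0..1 / w} \<subseteq> {y. poly q y = 0}" using one by (auto simp: q)
    ultimately have "finite {0..1 / w}" by (rule rev_finite_subset)
    then show False using r by (simp add: infinite_Icc)
  qed
  \<comment> \<open>Being constant on an interval, the polynomial is constant beyond it, but at
    \<open>2 / w\<close> the second form has the value 2.\<close>
  then have "m x0 (2 / w) = 1" using q[of "2 / w"] pe by simp
  then have "m 0 (2 / w) \<le> 1" using max[of x0 "2 / w"] x0 r by simp
  then show False using r by (simp add: my)
qed

section \<open>Determinants and real eigenvalues\<close>

text \<open>Serves to evaluate a determinant with polynomial entries at real and at complex
  points.\<close>

lemma ring_hom_det:
  fixes h :: "'a::comm_ring_1 \<Rightarrow> 'b::comm_ring_1" and A :: "'a^'n^'n"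
  assumes add: "\<And>x y. h (x + y) = h x + h y" and mult: "\<And>x y. h (x * y) = h x * h y"
    and one: "h 1 = 1"
  shows "h (det A) = det (\<chi> i j. h (A $ i $ j))"
proof -
  have zero: "h 0 = 0" using add[of 0 0] by simp
  have "h (- 1) = - 1" using add[of 1 "- 1"] one zero by (simp add: eq_neg_iff_add_eq_0 add.commute)
  then have sgn: "h (of_int (sign \<pi>)) = of_int (sign \<pi>)" for \<pi> :: "'n \<Rightarrow> 'n"
    by (simp add: sign_def one)
  have prod: "h (prod f S) = (\<Prod>i\<in>S. h (f i))" if "finite S" for f and S :: "'n set"
    using that by induction (simp_all add: one mult)
  have sum: "h (sum f S) = (\<Sum>\<pi>\<in>S. h (f \<pi>))" if "finite S" for f and S :: "('n \<Rightarrow> 'n) set"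
    using that by induction (simp_all add: zero add)
  show ?thesis
    by (simp add: det_def sum finite_permutations mult sgn prod)
qed

lemma det_eq_0_iff_kernel:
  fixes A :: "'a::field^'n^'n"
  shows "det A = 0 \<longleftrightarrow> (\<exists>x. x \<noteq> 0 \<and> A *v x = 0)"
  using matrix_left_invertible_ker[of A] invertible_left_inverse[of A] invertible_det_nz[of A] by blast

lemma real_polynomial_function_det: "real_polynomial_function (det :: real^'n^'n \<Rightarrow> real)"
proof -
  have "real_polynomial_function (\<lambda>A::real^'n^'n. A $ i $ j)" for i j
    by (intro real_polynomial_function.intros(1)
        bounded_linear_compose[OF bounded_linear_vec_nth bounded_linear_vec_nth])
  then show ?thesis
    unfolding det_def[abs_def]
    by (intro real_polynomial_function_sum real_polynomial_function_prod
        real_polynomial_function.intros(2,4)) (auto simp: finite_permutations)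
qed

lemma det_scaleR: "det (c *\<^sub>R A) = c ^ CARD('n) * det (A :: real^'n^'n)"
proof -
  have "c *\<^sub>R A = (\<chi> i. c *s A $ i)" by (simp add: vec_eq_iff)
  then show ?thesis using det_rows_mul[of "\<lambda>_. c" "\<lambda>i. A $ i"] by simp
qed

lemma inner_symmetric_matrix:
  fixes X :: "real^'n^'n"
  assumes "transpose X = X"
  shows "x \<bullet> (X *v y) = y \<bullet> (X *v x)"
  by (metis assms dot_lmul_matrix inner_commute transpose_matrix_vector)

lemma inner_matrix_vector_mult:
  "x \<bullet> (X *v x) = (\<Sum>i\<in>UNIV. \<Sum>j\<in>UNIV. x $ i * X $ i $ j * x $ j)" for X :: "real^'n^'n"
  by (simp add: inner_vec_def matrix_vector_mult_def sum_distrib_left mult.assoc)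

text \<open>The number v* X v is its own conjugate by symmetry, and it equals z times the positive
  number |v|^2.\<close>

lemma symmetric_complex_eigenvalue_real:
  fixes X :: "real^'n^'n" and v :: "complex^'n"
  assumes X: "transpose X = X" and v: "v \<noteq> 0"
    and eig: "\<And>i. (\<Sum>j\<in>UNIV. of_real (X $ i $ j) * v $ j) = z * v $ i"
  shows "z \<in> \<real>"
proof -
  let ?L = "\<Sum>i\<in>UNIV. \<Sum>j\<in>UNIV. cnj (v $ i) * of_real (X $ i $ j) * v $ j"
  define n where "n = (\<Sum>i\<in>UNIV. (cmod (v $ i))\<^sup>2)"
  have sym: "X $ i $ j = X $ j $ i" for i j using X by (metis transpose_def vec_lambda_beta)
  have "cnj ?L = (\<Sum>i\<in>UNIV. \<Sum>j\<in>UNIV. cnj (v $ j) * of_real (X $ j $ i) * v $ i)"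
    using sym by (simp add: mult_ac)
  also have "\<dots> = ?L" by (rule sum.swap)
  finally have "?L \<in> \<real>" by (simp add: Reals_cnj_iff)
  moreover have "?L = (\<Sum>i\<in>UNIV. cnj (v $ i) * (z * v $ i))"
    by (simp add: eig[symmetric] sum_distrib_left mult.assoc)
  then have "?L = z * of_real n"
    by (simp add: n_def sum_distrib_left complex_norm_square mult_ac del: of_real_power)
  moreover have "n \<noteq> 0"
  proof
    assume "n = 0"
    then have "v $ i = 0" for i by (auto simp: n_def sum_nonneg_eq_0_iff)
    then show False using v by (simp add: vec_eq_iff)
  qed
  ultimately show ?thesis by (metis Reals_divide Reals_of_real nonzero_mult_div_cancel_right of_real_eq_0_iff)
qed

text \<open>\<open>real_rooted\<close> concerns complex roots, whereas \<open>line_poly\<close> is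
  specified by real values only. The determinant of the polynomial matrix \<open>A\<close> is the
  same polynomial, and at a complex \<open>z\<close> it becomes the determinant of X - z I; a root
  then gives an eigenvector.\<close>

lemma real_rooted_charpoly:
  fixes X :: "real^'n^'n"
  assumes "transpose X = X"
  shows "real_rooted (line_poly det X (- mat 1))"
proof -
  define A :: "real poly^'n^'n" where "A = (\<chi> i j. [:X $ i $ j, - (if i = j then 1 else 0):])"
  have "poly (line_poly det X (- mat 1)) t = poly (det A) t" for t
  proof -
    have "X + t *\<^sub>R (- mat 1) = (\<chi> i j. poly (A $ i $ j) t)"
      by (simp add: A_def mat_def vec_eq_iff)
    then show ?thesis
      using ring_hom_det[of "\<lambda>p. poly p t" A]
      by (simp add: poly_line_poly[OF real_polynomial_function_det])
  qed
  then have eq: "line_poly det X (- mat 1) = det A" by (simp flip: poly_eq_poly_eq_iff add: fun_eq_iff)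
  show ?thesis
    unfolding real_rooted_def eq
  proof (intro allI impI)
    fix z :: complex
    assume z: "poly (map_poly of_real (det A)) z = 0"
    define B :: "complex^'n^'n" where "B = (\<chi> i j. of_real (X $ i $ j) - (if i = j then z else 0))"
    have "poly (map_poly of_real (det A)) z = det (\<chi> i j. poly (map_poly of_real (A $ i $ j)) z)"
      by (rule ring_hom_det) (simp_all add: poly_map_poly_of_real_add poly_map_poly_of_real_mult)
    also have "(\<chi> i j. poly (map_poly of_real (A $ i $ j)) z) = B"
      by (simp add: A_def B_def vec_eq_iff map_poly_pCons)
    finally have "det B = 0" using z by simp
    then obtain v where v: "v \<noteq> 0" "B *v v = 0" using det_eq_0_iff_kernel by blast
    have "(\<Sum>j\<in>UNIV. of_real (X $ i $ j) * v $ j) = z * v $ i" for i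
    proof -
      have "0 = (B *v v) $ i" using v by simp
      also have "\<dots> = (\<Sum>j\<in>UNIV. of_real (X $ i $ j) * v $ j - (if i = j then z * v $ j else 0))"
        by (auto simp: matrix_vector_mult_def B_def left_diff_distrib intro!: sum.cong)
      finally show ?thesis by (simp add: sum_subtractf)
    qed
    then show "z \<in> \<real>" by (rule symmetric_complex_eigenvalue_real[OF assms v(1)])
  qed
qed

lemma psd_isotropic_in_kernel:
  fixes X :: "real^'n^'n"
  assumes sym: "transpose X = X" and psd: "\<And>v. 0 \<le> v \<bullet> (X *v v)" and "u \<bullet> (X *v u) = 0"
  shows "X *v u = 0"
proof -
  have "w \<bullet> (X *v u) = 0" for w
  proof (rule linear_term_zero_if_nonneg)
    fix h
    show "0 \<le> 2 * h * (w \<bullet> (X *v u)) + h\<^sup>2 * (w \<bullet> (X *v w))"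
      using psd[of "u + h *\<^sub>R w"] assms(3) inner_symmetric_matrix[OF sym, of u w]
      by (simp add: matrix_vector_right_distrib matrix_vector_mult_scaleR inner_add_left
          inner_add_right power2_eq_square algebra_simps)
  qed
  from this[of "X *v u"] show ?thesis by simp
qed

text \<open>Let t be the minimum of the form on the unit sphere. Then X - t I is positive
  semidefinite and the minimizer is isotropic for it, hence an eigenvector of \<open>X\<close> for
  t.\<close>

lemma psd_if_nonneg_eigenvalues:
  fixes X :: "real^'n^'n"
  assumes sym: "transpose X = X"
    and eig: "\<And>u t. u \<noteq> 0 \<Longrightarrow> X *v u = t *\<^sub>R u \<Longrightarrow> 0 \<le> t"
  shows "0 \<le> v \<bullet> (X *v v)"
proof -
  let ?S = "sphere (0 :: real^'n) 1"
  have cont: "continuous_on ?S (\<lambda>u. u \<bullet> (X *v u))"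
    by (intro continuous_intros linear_continuous_on matrix_vector_mul_bounded_linear)
  have ne: "?S \<noteq> {}" using vector_choose_size[of 1] by (metis mem_sphere_0 empty_iff zero_le_one)
  obtain u where u: "u \<in> ?S" and min: "\<And>w. w \<in> ?S \<Longrightarrow> u \<bullet> (X *v u) \<le> w \<bullet> (X *v w)"
    using continuous_attains_inf[OF compact_sphere ne cont] by blast
  define t where "t = u \<bullet> (X *v u)"
  have uu: "u \<bullet> u = 1" using u by (simp add: dot_square_norm)
  have ray: "t * (w \<bullet> w) \<le> w \<bullet> (X *v w)" for w
  proof (cases "w = 0")
    case False
    then have "t \<le> (w /\<^sub>R norm w) \<bullet> (X *v (w /\<^sub>R norm w))"
      unfolding t_def by (intro min) simp
    also have "\<dots> = (w \<bullet> (X *v w)) / (w \<bullet> w)"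
      by (simp add: matrix_vector_mult_scaleR dot_square_norm power2_eq_square divide_inverse)
    finally show ?thesis using False by (simp add: pos_le_divide_eq)
  qed simp
  define Y where "Y = X - t *\<^sub>R mat 1"
  have Y: "Y *v w = X *v w - t *\<^sub>R w" for w
    by (simp add: Y_def matrix_vector_mult_diff_rdistrib scaleR_matrix_vector_assoc[symmetric])
  have "transpose Y = Y" using sym by (simp add: Y_def transpose_def mat_def vec_eq_iff)
  then have "Y *v u = 0"
    by (rule psd_isotropic_in_kernel) (use ray uu in \<open>auto simp: Y inner_diff_right t_def\<close>)
  then have "0 \<le> t" using uu by (intro eig[of u]) (auto simp: Y)
  then show ?thesis using ray[of v] by (meson inner_ge_zero mult_nonneg_nonneg order_trans)
qed

lemma mem_det_hyperbolicity_cone_iff: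
  fixes X :: "real^'n^'n"
  assumes "transpose X = X"
  shows "(\<forall>t. poly (line_poly det (- X) (mat 1)) t = 0 \<longrightarrow> 0 \<le> t) \<longleftrightarrow> (\<forall>v. 0 \<le> v \<bullet> (X *v v))"
proof -
  have root: "poly (line_poly det (- X) (mat 1)) t = 0 \<longleftrightarrow> (\<exists>u. u \<noteq> 0 \<and> X *v u = t *\<^sub>R u)" for t
  proof -
    have "(- X + t *\<^sub>R mat 1) *v u = t *\<^sub>R u - X *v u" for u
      by (simp add: matrix_vector_mult_diff_rdistrib scaleR_matrix_vector_assoc[symmetric])
    then show ?thesis
      unfolding poly_line_poly[OF real_polynomial_function_det] det_eq_0_iff_kernel by auto
  qed
  show ?thesis
  proof
    assume "\<forall>t. poly (line_poly det (- X) (mat 1)) t = 0 \<longrightarrow> 0 \<le> t"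
    then show "\<forall>v. 0 \<le> v \<bullet> (X *v v)" using psd_if_nonneg_eigenvalues[OF assms] root by blast
  next
    assume psd: "\<forall>v. 0 \<le> v \<bullet> (X *v v)"
    show "\<forall>t. poly (line_poly det (- X) (mat 1)) t = 0 \<longrightarrow> 0 \<le> t"
    proof (intro allI impI)
      fix t assume "poly (line_poly det (- X) (mat 1)) t = 0"
      then obtain u where "u \<noteq> 0" "X *v u = t *\<^sub>R u" using root by blast
      then have "0 \<le> t * (u \<bullet> u)" "0 < u \<bullet> u" using psd[rule_format, of u] by auto
      then show "0 \<le> t" by (simp add: zero_le_mult_iff del: inner_gt_zero_iff)
    qed
  qed
qed

section \<open>Rank of the matrices y y^T\<close>

definition outer :: "real^'n \<Rightarrow> real^'n^'n" where
  "outer y = (\<chi> i j. y $ i * y $ j)"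

lemma outer_mult: "(A ** outer y ** transpose A) = outer (A *v y)"
  by (simp add: outer_def matrix_matrix_mult_def transpose_def matrix_vector_mult_def vec_eq_iff
      sum_product sum_distrib_left sum_distrib_right mult_ac)

text \<open>An orthogonal change of basis moves \<open>y\<close> onto a coordinate axis. It fixes t
  I and makes the matrix diagonal, with a single entry different from t unless \<open>y\<close> is
  zero.\<close>

lemma det_outer:
  fixes y :: "real^'n"
  shows "det (t *\<^sub>R mat 1 - outer y) = t ^ (CARD('n) - 1) * (t - y \<bullet> y)"
proof -
  \<comment> \<open>Any axis will do; this only picks an index.\<close>
  obtain k :: 'n where True by simp
  have "norm y = norm (axis k (norm y) :: real^'n)" by (simp add: norm_eq_sqrt_inner inner_axis_axis)
  then obtain f where f: "orthogonal_transformation f" "f y = axis k (norm y)"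
    by (rule orthogonal_transformation_exists)
  define A where "A = matrix f"
  have A: "orthogonal_matrix A" and "linear f"
    using f(1) by (simp_all add: A_def orthogonal_transformation_matrix)
  then have Ay: "A *v y = axis k (norm y)" using f(2) by (simp add: A_def matrix_works)
  have AA: "A ** transpose A = mat 1" using A by (simp add: orthogonal_matrix_def)
  then have "det A * det (transpose A) = 1" by (metis det_I det_mul)
  then have "det (t *\<^sub>R mat 1 - outer y) = det (A ** (t *\<^sub>R mat 1 - outer y) ** transpose A)"
    by (simp add: det_mul mult_ac)
  also have "A ** (t *\<^sub>R mat 1 - outer y) ** transpose A
      = t *\<^sub>R (A ** mat 1 ** transpose A) - A ** outer y ** transpose A"
    by (simp add: matrix_add_ldistrib matrix_matrix_mult_def vec_eq_iff sum_distrib_left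
        sum_distrib_right algebra_simps sum.distrib sum_negf sum_subtractf)
  also have "\<dots> = t *\<^sub>R mat 1 - outer (axis k (norm y))"
    by (simp add: outer_mult Ay AA)
  also have "det \<dots> = (\<Prod>i\<in>UNIV. (t *\<^sub>R mat 1 - outer (axis k (norm y))) $ i $ i)"
    by (rule det_diagonal) (auto simp: outer_def axis_def mat_def)
  also have "\<dots> = (\<Prod>i\<in>UNIV. if i = k then t - y \<bullet> y else t)"
    by (intro prod.cong) (auto simp: outer_def axis_def mat_def dot_square_norm power2_eq_square)
  also have "\<dots> = (t - y \<bullet> y) * (\<Prod>i\<in>UNIV - {k}. t)"
    by (subst prod.remove[of _ k]) auto
  finally show ?thesis by (simp add: card_Diff_singleton mult.commute)
qed

lemma hyperbolic_rank_outer: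
  fixes y :: "real^'n"
  assumes "y \<noteq> 0"
  shows "hyperbolic_rank det (mat 1) (outer y) = 1"
proof -
  let ?r = "y \<bullet> y"
  define q where "q = line_poly det (- outer y) (mat 1)"
  have r: "?r \<noteq> 0" using assms by simp
  have "poly q t = poly (monom 1 (CARD('n) - 1) * [:- ?r, 1:]) t" for t
    by (simp add: q_def poly_line_poly[OF real_polynomial_function_det] det_outer poly_monom
        algebra_simps)
  then have q: "q = monom 1 (CARD('n) - 1) * [:- ?r, 1:]"
    by (simp flip: poly_eq_poly_eq_iff add: fun_eq_iff)
  have "q \<noteq> 0" unfolding q by (simp add: monom_eq_0_iff del: mult_pCons_right)
  then have "order ?r q = order ?r (monom 1 (CARD('n) - 1)) + order ?r [:- ?r, 1:]"
    unfolding q by (rule order_mult)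
  also have "order ?r (monom 1 (CARD('n) - 1)) = 0"
    using r by (intro order_0I) (simp add: poly_monom)
  also have "order ?r [:- ?r, 1:] = 1" using order_power_n_n[of ?r 1] by simp
  finally have "order ?r q = 1" by simp
  moreover have "{t. t \<noteq> 0 \<and> poly q t = 0} = {?r}"
    using r unfolding q by (auto simp: poly_monom simp del: mult_pCons_right)
  ultimately show ?thesis unfolding hyperbolic_rank_def q_def[symmetric] by simp
qed

section \<open>Cones of disjoint unions of cliques\<close>

lemma disjoint_union_of_cliques_trans:
  assumes "disjoint_union_of_cliques E" "{a, b} \<in> E" "{b, c} \<in> E" "a \<noteq> c"
  shows "{a, c} \<in> E"
proof -
  have "(a, b) \<in> {(u, w). {u, w} \<in> E}" "(b, c) \<in> {(u, w). {u, w} \<in> E}" using assms by auto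
  then have "(a, c) \<in> {(u, w). {u, w} \<in> E}\<^sup>*" by (meson r_into_rtrancl rtrancl_trans)
  then have "c \<in> component_of_vertex E a" "a \<in> component_of_vertex E a"
    by (auto simp: component_of_vertex_def)
  then show ?thesis using assms(1,4) unfolding disjoint_union_of_cliques_def clique_def by blast
qed

text \<open>Closed neighbourhoods partition the vertices because adjacency is transitive, and
  \<open>X\<close> vanishes between different ones.\<close>

lemma sum_over_blocks:
  fixes X :: "real^'n::finite^'n" and E :: "'n set set"
  assumes E: "disjoint_union_of_cliques E"
    and X: "X \<in> graph_matrices E"
  obtains P where "\<And>C. C \<in> P \<Longrightarrow> clique C E"
    and "\<And>x. (\<Sum>i\<in>UNIV. \<Sum>j\<in>UNIV. x i * X $ i $ j * x j) =
      (\<Sum>C\<in>P. \<Sum>i\<in>C. \<Sum>j\<in>C. x i * X $ i $ j * x j)"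
proof -
  note trans = disjoint_union_of_cliques_trans[OF E]
  define cl where "cl i = {j. i = j \<or> {i, j} \<in> E}" for i
  have eq: "cl i = cl j" if "j \<in> cl i" for i j
    using that trans[of j i] trans[of i j] unfolding cl_def by (auto simp: insert_commute)
  have mem: "i \<in> cl i" for i by (simp add: cl_def)
  have block: "{i \<in> UNIV. cl i = C} = C" if C: "C \<in> range cl" for C
  proof -
    obtain k where k: "C = cl k" using C by blast
    have "cl i = cl k \<longleftrightarrow> i \<in> cl k" for i using eq[of i k] mem[of i] by metis
    then show ?thesis unfolding k by simp
  qed
  have clique: "clique C E" if C: "C \<in> range cl" for C
    unfolding clique_def
  proof (intro ballI impI)
    fix u w assume uw: "u \<in> C" "w \<in> C" "u \<noteq> w"
    obtain k where "C = cl k" using C by blast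
    then have "w \<in> cl u" using eq[of u k] uw by blast
    then show "{u, w} \<in> E" using uw(3) by (simp add: cl_def)
  qed
  have "(\<Sum>i\<in>UNIV. \<Sum>j\<in>UNIV. x i * X $ i $ j * x j) =
      (\<Sum>C\<in>range cl. \<Sum>i\<in>C. \<Sum>j\<in>C. x i * X $ i $ j * x j)" for x
  proof -
    have "(\<Sum>j\<in>UNIV. x i * X $ i $ j * x j) = (\<Sum>j\<in>cl i. x i * X $ i $ j * x j)" for i
      using X by (intro sum.mono_neutral_right) (auto simp: cl_def graph_matrices_def)
    then have "(\<Sum>i\<in>UNIV. \<Sum>j\<in>UNIV. x i * X $ i $ j * x j) =
        (\<Sum>i\<in>UNIV. \<Sum>j\<in>cl i. x i * X $ i $ j * x j)" by simp
    also have "\<dots> = (\<Sum>C\<in>range cl. \<Sum>i\<in>{i \<in> UNIV. cl i = C}. \<Sum>j\<in>cl i. x i * X $ i $ j * x j)"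
      by (rule sum.group[symmetric]) auto
    also have "\<dots> = (\<Sum>C\<in>range cl. \<Sum>i\<in>{i \<in> UNIV. cl i = C}. \<Sum>j\<in>C. x i * X $ i $ j * x j)"
      by (intro sum.cong) auto
    also have "\<dots> = (\<Sum>C\<in>range cl. \<Sum>i\<in>C. \<Sum>j\<in>C. x i * X $ i $ j * x j)"
      using block by (intro sum.cong) auto
    finally show ?thesis .
  qed
  then show ?thesis using clique that by blast
qed

lemma graph_cone_eq_psd:
  fixes E :: "'n::finite set set"
  assumes E: "disjoint_union_of_cliques E"
  shows "graph_cone E = {X \<in> graph_matrices E. \<forall>v. 0 \<le> v \<bullet> (X *v v)}"
proof (intro set_eqI iffI)
  fix X assume X: "X \<in> graph_cone E"
  then have V: "X \<in> graph_matrices E" by (simp add: graph_cone_def)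
  obtain P where P: "\<And>C. C \<in> P \<Longrightarrow> clique C E"
    and sum: "\<And>x. (\<Sum>i\<in>UNIV. \<Sum>j\<in>UNIV. x i * X $ i $ j * x j) =
      (\<Sum>C\<in>P. \<Sum>i\<in>C. \<Sum>j\<in>C. x i * X $ i $ j * x j)"
    using sum_over_blocks[OF E V] by blast
  have "0 \<le> v \<bullet> (X *v v)" for v
    unfolding inner_matrix_vector_mult sum
  proof (rule sum_nonneg)
    fix C assume "C \<in> P"
    then have "psd_submatrix C X" using X P by (simp add: graph_cone_def)
    then show "0 \<le> (\<Sum>i\<in>C. \<Sum>j\<in>C. v $ i * X $ i $ j * v $ j)"
      unfolding psd_submatrix_def by (rule spec)
  qed
  then show "X \<in> {X \<in> graph_matrices E. \<forall>v. 0 \<le> v \<bullet> (X *v v)}" using V by simp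
next
  fix X assume X: "X \<in> {X \<in> graph_matrices E. \<forall>v. 0 \<le> v \<bullet> (X *v v)}"
  have "psd_submatrix C X" for C
    unfolding psd_submatrix_def
  proof
    fix x :: "'n \<Rightarrow> real"
    \<comment> \<open>Extension by zero turns the form on the block into the form on the whole
      space.\<close>
    define v :: "real^'n" where "v = (\<chi> i. if i \<in> C then x i else 0)"
    have "0 \<le> v \<bullet> (X *v v)" using X by simp
    also have "\<dots> = (\<Sum>i\<in>C. \<Sum>j\<in>UNIV. v $ i * X $ i $ j * v $ j)"
      unfolding inner_matrix_vector_mult by (rule sum.mono_neutral_right) (auto simp: v_def)
    also have "\<dots> = (\<Sum>i\<in>C. \<Sum>j\<in>C. v $ i * X $ i $ j * v $ j)"
      by (intro sum.cong refl sum.mono_neutral_right) (auto simp: v_def)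
    also have "\<dots> = (\<Sum>i\<in>C. \<Sum>j\<in>C. x i * X $ i $ j * x j)"
      by (intro sum.cong refl) (auto simp: v_def)
    finally show "0 \<le> (\<Sum>i\<in>C. \<Sum>j\<in>C. x i * X $ i $ j * x j)" .
  qed
  then show "X \<in> graph_cone E" using X by (simp add: graph_cone_def)
qed

lemma outer_quadratic_form: "v \<bullet> (outer y *v v) = (v \<bullet> y)\<^sup>2"
  unfolding inner_matrix_vector_mult
  by (simp add: outer_def inner_vec_def power2_eq_square sum_product mult_ac)

text \<open>
  Subtracting from \<open>X\<close> the Schur complement term \<open>Y\<close> of a positive diagonal entry leaves a
  positive semidefinite matrix, and \<open>Y\<close> has the zero pattern of \<open>X\<close> because adjacency is
  transitive; so an extreme \<open>X\<close> is a multiple of the rank-one matrix \<open>Y\<close>.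
\<close>

lemma extreme_ray_graph_cone_outer:
  fixes E :: "'n::finite set set"
  assumes E: "disjoint_union_of_cliques E"
    and R: "extreme_ray R (graph_cone E)"
  obtains y where "y \<noteq> 0" "R = cone hull {outer y}"
proof -
  note trans = disjoint_union_of_cliques_trans[OF E]
  obtain X where X0: "X \<noteq> 0" and RX: "R = cone hull {X}" and face: "R face_of graph_cone E"
    using R unfolding extreme_ray_def by blast
  have XR: "X \<in> R" by (simp add: RX hull_inc)
  then have XK: "X \<in> graph_cone E" using face face_of_imp_subset by blast
  then have XV: "X \<in> graph_matrices E" and psd: "\<And>v. 0 \<le> v \<bullet> (X *v v)"
    using graph_cone_eq_psd[OF E] by blast+
  have tr: "transpose X = X" using XV by (simp add: graph_matrices_def)
  obtain i j where "X $ i $ j \<noteq> 0" using X0 by (auto simp: vec_eq_iff)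
  then have "X $ i $ i \<noteq> 0" using graph_cone_zero_diag[OF XK] by blast
  then have pos: "0 < X $ i $ i" using graph_cone_diag_nonneg[OF XK, of i] by simp
  define d where "d = X $ i $ i"
  \<comment> \<open>Column \<open>i\<close>, scaled so that \<open>outer y\<close> agrees with
    \<open>X\<close> in row and column \<open>i\<close>.\<close>
  define y where "y = (1 / sqrt d) *\<^sub>R (X *v axis i 1)"
  have y: "y $ j = X $ j $ i / sqrt d" for j
    by (simp add: y_def matrix_vector_mult_basis column_def)
  have "y $ i \<noteq> 0" using pos by (simp add: y d_def)
  then have y0: "y \<noteq> 0" by auto
  let ?Y = "outer y"
  have Yii: "?Y $ i $ i = d" using pos by (simp add: outer_def y d_def power2_eq_square[symmetric] flip: real_sqrt_mult)
  have YV: "?Y \<in> graph_matrices E"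
  proof -
    have adj: "k = i \<or> {i, k} \<in> E" if "y $ k \<noteq> 0" for k
    proof -
      have "X $ k $ i \<noteq> 0" using that by (auto simp: y)
      then have "k = i \<or> {k, i} \<in> E" using XV by (auto simp: graph_matrices_def)
      then show ?thesis by (simp add: insert_commute)
    qed
    have "?Y $ k $ l = 0" if "k \<noteq> l" "{k, l} \<notin> E" for k l
    proof (rule ccontr)
      assume "?Y $ k $ l \<noteq> 0"
      then have "k = i \<or> {k, i} \<in> E" "l = i \<or> {i, l} \<in> E"
        using adj[of k] adj[of l] by (auto simp: outer_def insert_commute)
      then show False using trans[of k i l] that by auto
    qed
    then show ?thesis by (auto simp: graph_matrices_def transpose_def outer_def vec_eq_iff mult.commute)
  qed
  have le: "(v \<bullet> y)\<^sup>2 \<le> v \<bullet> (X *v v)" for v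
  proof -
    define a where "a = v \<bullet> (X *v axis i 1)"
    have vy: "(v \<bullet> y)\<^sup>2 = a\<^sup>2 / d" using pos by (simp add: y_def a_def power_divide d_def)
    have ee: "axis i 1 \<bullet> (X *v axis i 1) = d"
      by (simp add: inner_axis' matrix_vector_mult_basis column_def d_def)
    have ev: "axis i 1 \<bullet> (X *v v) = a"
      unfolding a_def by (rule inner_symmetric_matrix[OF tr])
    \<comment> \<open>Completing the square: \<open>a / d\<close> minimizes the form on the line
      through \<open>v\<close> along the axis.\<close>
    have "0 \<le> (v - (a / d) *\<^sub>R axis i 1) \<bullet> (X *v (v - (a / d) *\<^sub>R axis i 1))" by (rule psd)
    also have "\<dots> = v \<bullet> (X *v v) - a\<^sup>2 / d"
      using pos
      by (simp add: matrix_vector_mult_diff_distrib matrix_vector_mult_scaleR inner_diff_left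
          inner_diff_right ee ev a_def[symmetric] power2_eq_square field_simps d_def)
    finally show ?thesis by (simp add: vy)
  qed
  have YK: "?Y \<in> graph_cone E"
    using YV unfolding graph_cone_eq_psd[OF E] by (simp add: outer_quadratic_form)
  have ZK: "X - ?Y \<in> graph_cone E"
    using XV YV le unfolding graph_cone_eq_psd[OF E]
    by (auto simp: subspace_diff[OF subspace_graph_matrices] matrix_vector_mult_diff_rdistrib
        inner_diff_right outer_quadratic_form)
  have scale: "c *\<^sub>R X \<in> R" if "0 \<le> c" for c
    using that unfolding RX cone_hull_singleton by blast
  have "?Y \<in> R"
  \<comment> \<open>An open segment between equal points is empty, so the face property cannot be
    applied in this case.\<close>
  proof (cases "?Y = X - ?Y")
    case True
    then have "X = 2 *\<^sub>R ?Y" by (simp add: scaleR_2 eq_diff_eq)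
    then have "?Y = (1 / 2) *\<^sub>R X" by simp
    then show ?thesis using scale[of "1 / 2"] by simp
  next
    case False
    have "(1 / 2) *\<^sub>R X \<in> R" by (rule scale) simp
    moreover have "(1 / 2) *\<^sub>R X = midpoint ?Y (X - ?Y)" by (simp add: midpoint_def)
    then have "(1 / 2) *\<^sub>R X \<in> open_segment ?Y (X - ?Y)" using False by simp
    ultimately show ?thesis using face YK ZK unfolding face_of_def by blast
  qed
  then obtain k where k: "?Y = k *\<^sub>R X" "0 \<le> k" by (auto simp: RX cone_hull_singleton)
  have "k \<noteq> 0" using k(1) Yii pos by (auto simp: d_def)
  have "R = cone hull {?Y}"
  proof -
    have X: "c *\<^sub>R X = (c / k) *\<^sub>R ?Y" "0 \<le> c / k" if "0 \<le> c" for c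
      using k \<open>k \<noteq> 0\<close> that by simp_all
    have "c *\<^sub>R ?Y = (c * k) *\<^sub>R X" "0 \<le> c * k" if "0 \<le> c" for c
      using k that by simp_all
    with X have "{c *\<^sub>R X | c. 0 \<le> c} = {c *\<^sub>R ?Y | c. 0 \<le> c}" by blast
    then show ?thesis by (simp add: RX cone_hull_singleton)
  qed
  with y0 show ?thesis by (rule that)
qed

lemma ROG_realizable_if_disjoint_union_of_cliques:
  fixes E :: "'n::finite set set"
  assumes "disjoint_union_of_cliques E"
  shows "ROG_realizable (graph_matrices E) (graph_cone E)"
proof -
  let ?V = "graph_matrices E"
  have tr: "transpose X = X" if "X \<in> ?V" for X using that by (simp add: graph_matrices_def)
  have "homogeneous_on ?V det"
    unfolding homogeneous_on_def using det_scaleR by blast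
  moreover have "mat 1 \<in> ?V"
    by (auto simp: graph_matrices_def transpose_def mat_def vec_eq_iff)
  ultimately have hyp: "hyperbolic_on ?V det (mat 1)"
    unfolding hyperbolic_on_def by (simp add: real_polynomial_function_det real_rooted_charpoly tr)
  have cone: "hyperbolicity_cone ?V det (mat 1) = graph_cone E"
    unfolding hyperbolicity_cone_def graph_cone_eq_psd[OF assms]
    using mem_det_hyperbolicity_cone_iff tr by blast
  have "rank_one_generated ?V det (mat 1)"
    unfolding rank_one_generated_def cone
    using extreme_ray_graph_cone_outer[OF assms] hyperbolic_rank_outer by metis
  then show ?thesis unfolding ROG_realizable_def using hyp cone by blast
qed

theorem theorem4p1:
  fixes E :: "'n::finite set set"
  assumes "simple_graph E"
    and "chordal E"
  shows "ROG_realizable (graph_matrices E) (graph_cone E) \<longleftrightarrow> disjoint_union_of_cliques E"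
  using ROG_realizable_if_disjoint_union_of_cliques not_ROG_realizable_if_path
    not_disjoint_union_of_cliques_obtain_path[OF assms(1)] by metis

end
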